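(* Let $a,h,d,k,K$ be positive integers with $\gcd(a,d)=1$ and $K-1>k\ge2$, and let $A(a)=(a,ha+d,ha+2d,\dots,ha+kd,ha+Kd)$. Write $K=sk+t$ with $0\le t\le k-1$ and $s\ge1$, and let $Q=\left\lfloor\frac{a}{K}\right\rfloor$; let $j$ denote the residue of $a$ modulo $K$, $0\le j\le K-1$. (i) If $2\le t\le k-1$, $h\ge\left\lceil\frac ds\right\rceil$ and $a\ge sK$, then $$g(A(a))=\begin{cases}(Q+s)ha+KdQ-a-d & \text{if } j\in\{0,1,\dots,(s-1)k+1\},\\ (Q+s)ha+KdQ-a+(j-1)d & \text{if } j\in\{(s-1)k+2,\dots,sk+1\},\\ (Q+s+1)ha+KdQ-a+(j-1)d & \text{if } j\in\{sk+2,\dots,K-1\}.\end{cases}$$ (ii) If $t\in\{0,1\}$, $h\ge\left\lceil\frac{d}{s-1}\right\rceil$ and $a\ge(s-1)K$, then $$g(A(a))=\begin{cases}(Q+s-1)ha+KdQ-a-d & \text{if } j\in\{0,1,\dots,(s-2)k+1\},\\ (Q+s-1)ha+KdQ-a+(j-1)d & \text{if } j\in\{(s-2)k+2,\dots,(s-1)k+1\},\\ (Q+s)ha+KdQ-a+(j-1)d & \text{if } j\in\{(s-1)k+2,\dots,K-1\}.\end{cases}$$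
   Context: For positive integers $a_1,\dots,a_n$ with $\gcd=1$, the Frobenius number $g(a_1,\dots,a_n)$ is the largest integer not representable as $\sum x_ia_i$ with nonnegative integers $x_i$. *)

theory Defs
  imports Complex_Main
begin

definition representable :: "int list \<Rightarrow> int \<Rightarrow> bool" where
  "representable as m \<longleftrightarrow>
     (\<exists>x :: nat \<Rightarrow> nat. m = (\<Sum>i<length as. int (x i) * as ! i))"

text \<open>The maximum ranges over all integers, so the value is \<open>-1\<close> when every nonnegative
  integer is representable.  For positive entries with gcd 1 the maximum exists.\<close>

definition frobenius :: "int list \<Rightarrow> int" where
  "frobenius as = (GREATEST m. \<not> representable as m)"

definition seqA :: "int \<Rightarrow> int \<Rightarrow> int \<Rightarrow> int \<Rightarrow> int \<Rightarrow> int list" where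
  "seqA a h d k K = a # map (\<lambda>i. h * a + i * d) [1..k] @ [h * a + K * d]"

end

theory Submission
  imports Defs
begin

text \<open>An element of the semigroup is \<open>x * a + n * (h * a) + R * d\<close>, where \<open>R\<close> is a sum of \<open>n\<close> coins
  from \<open>{1..k} \<union> {K}\<close>.  The greedy number \<open>M R\<close> of coins is minimal.  With
  \<open>S = \<lceil>(K - 1) / k\<rceil> - 1\<close>, the largest number of coins needed below \<open>K\<close> is \<open>S + 1\<close>, so
  \<open>a \<ge> S * K\<close> forces \<open>M r \<le> M (r + l * a)\<close>: the least element in the residue class of \<open>r * d\<close>
  modulo \<open>a\<close> is \<open>M r * h * a + r * d\<close> for \<open>0 \<le> r < a\<close>.  As \<open>K * d \<le> h * a\<close>, this is maximal at
  \<open>r = Q * K - 1\<close> or at \<open>r = a - 1\<close>, whichever needs more coins (at \<open>r = a - 1\<close> in case of a tie).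
  Both parts of the theorem are instances, with \<open>S = s\<close> and \<open>S = s - 1\<close>.\<close>

section \<open>Closure properties of the representable integers\<close>

lemma representable_0: "representable as 0"
  unfolding representable_def by (rule exI[of _ "\<lambda>_. 0"]) simp

lemma representable_add:
  assumes "representable as m" "representable as n"
  shows "representable as (m + n)"
proof -
  obtain x y :: "nat \<Rightarrow> nat" where
    "m = (\<Sum>i<length as. int (x i) * as ! i)" "n = (\<Sum>i<length as. int (y i) * as ! i)"
    using assms unfolding representable_def by blast
  then have "m + n = (\<Sum>i<length as. int (x i + y i) * as ! i)"
    by (simp add: sum.distrib distrib_right)
  then show ?thesis
    unfolding representable_def by (intro exI[of _ "\<lambda>i. x i + y i"])
qed

lemma representable_member:
  assumes "g \<in> set as"
  shows "representable as g"
proof -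
  obtain p where p: "p < length as" "as ! p = g"
    using assms by (auto simp: in_set_conv_nth)
  have "(\<Sum>i<length as. int (if i = p then 1 else 0) * as ! i)
      = (\<Sum>i<length as. if i = p then as ! i else 0)"
    by (rule sum.cong) auto
  also have "\<dots> = g"
    using p by simp
  finally show ?thesis
    unfolding representable_def by (intro exI[of _ "\<lambda>i. if i = p then 1 else 0"]) simp
qed

lemma representable_mult_nat:
  assumes "representable as g"
  shows "representable as (int n * g)"
proof (induction n)
  case 0
  then show ?case by (simp add: representable_0)
next
  case (Suc n)
  then have "representable as (int n * g + g)"
    by (intro representable_add assms)
  then show ?case by (simp add: algebra_simps)
qed

lemma representable_mult:
  assumes "representable as g" "0 \<le> c"
  shows "representable as (c * g)"
  using representable_mult_nat[OF assms(1), of "nat c"] assms(2) by simp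

text \<open>Trades coefficient vectors for adding one generator at a time, so that a coin count only
  has to be tracked through a single addition.\<close>

lemma representable_induct [consumes 1, case_names zero add]:
  assumes "representable as m" "P 0" and step: "\<And>y g. P y \<Longrightarrow> g \<in> set as \<Longrightarrow> P (y + g)"
  shows "P m"
proof -
  obtain x :: "nat \<Rightarrow> nat" where x: "m = (\<Sum>i<length as. int (x i) * as ! i)"
    using assms(1) unfolding representable_def by blast
  have mult: "P (y + int c * g)" if "P y" "g \<in> set as" for y g c
  proof (induction c)
    case 0
    then show ?case using that by simp
  next
    case (Suc c)
    then have "P (y + int c * g + g)" using that(2) by (rule step)
    then show ?case by (simp add: algebra_simps)
  qed
  have "P (\<Sum>i<l. int (x i) * as ! i)" if "l \<le> length as" for l
    using that
  proof (induction l)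
    case 0
    then show ?case using assms(2) by simp
  next
    case (Suc l)
    then show ?case by (simp add: mult)
  qed
  then show ?thesis using x by simp
qed

lemma set_seqA:
  "set (seqA a h d k K) = {a} \<union> (\<lambda>i. h * a + i * d) ` {1..k} \<union> {h * a + K * d}"
  by (auto simp: seqA_def)

section \<open>Arithmetic of the greedy coin count\<close>

text \<open>The second summand is ceil((r mod K) / k): once all coins \<open>K\<close> that fit are
  taken, the remainder is paid with coins of value at most \<open>k\<close>.\<close>

definition greedy_coins :: "int \<Rightarrow> int \<Rightarrow> int \<Rightarrow> int" where
  "greedy_coins k K r = r div K + (r mod K + k - 1) div k"

lemma zdiv_less_iff:
  fixes m n q :: int
  assumes "0 < q"
  shows "m div q < n \<longleftrightarrow> m < n * q"
proof -
  have "(m + (- n) * q) div q = m div q - n"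
    using assms by (subst div_mult_self1) auto
  then show ?thesis
    using pos_imp_zdiv_neg_iff[OF assms, of "m + (- n) * q"] by auto
qed

lemma ceil_div_le_iff:
  fixes u c k :: int
  assumes "k > 0"
  shows "(u + k - 1) div k \<le> c \<longleftrightarrow> u \<le> c * k"
proof -
  have "(u + k - 1) div k \<le> c \<longleftrightarrow> (u + k - 1) div k < c + 1" by auto
  also have "\<dots> \<longleftrightarrow> u + k - 1 < (c + 1) * k"
    using assms by (rule zdiv_less_iff)
  also have "\<dots> \<longleftrightarrow> u \<le> c * k" by (auto simp: algebra_simps)
  finally show ?thesis .
qed

lemma greedy_coins_block:
  fixes q u K :: int
  assumes "0 \<le> u" "u < K"
  shows "greedy_coins k K (q * K + u) = q + (u + k - 1) div k"
proof -
  have "(q * K + u) div K = q"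
    using assms by (intro int_div_pos_eq[of _ _ _ u]) (auto simp: algebra_simps)
  moreover have "(q * K + u) mod K = u"
    using assms by (intro int_mod_pos_eq[of _ _ q]) (auto simp: algebra_simps)
  ultimately show ?thesis by (simp add: greedy_coins_def)
qed

text \<open>Inside a block of length \<open>K\<close> the ceiling grows by at most one because i
  \<le> k. Crossing into the next block costs one in the quotient, but the new remainder
  \<open>u + i - K\<close> is below \<open>u\<close>, so the ceiling does not grow.\<close>

lemma greedy_coins_add_small:
  assumes "0 < k" "k < K" "1 \<le> i" "i \<le> k"
  shows "greedy_coins k K (r + i) \<le> greedy_coins k K r + 1"
proof -
  define q u where qu: "q = r div K" "u = r mod K"
  have r: "r = q * K + u" and u: "0 \<le> u" "u < K"
    using assms by (auto simp: qu)
  have Mr: "greedy_coins k K r = q + (u + k - 1) div k"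
    unfolding r using u by (rule greedy_coins_block)
  show ?thesis
  proof (cases "u + i < K")
    case True
    have "greedy_coins k K (r + i) = q + (u + i + k - 1) div k"
      using greedy_coins_block[of "u + i" K k q] True u assms by (simp add: r add.assoc)
    also have "\<dots> \<le> q + (u + k - 1 + k) div k"
      using assms by (intro add_left_mono zdiv_mono1) auto
    also have "\<dots> = q + (u + k - 1) div k + 1"
      using assms by (subst div_add_self2) auto
    finally show ?thesis by (simp add: Mr)
  next
    case False
    have "greedy_coins k K (r + i) = q + 1 + (u + i - K + k - 1) div k"
      using greedy_coins_block[of "u + i - K" K k "q + 1"] False u assms
      by (simp add: r algebra_simps)
    also have "\<dots> \<le> q + 1 + (u + k - 1) div k"
      using assms by (intro add_left_mono zdiv_mono1) auto
    finally show ?thesis by (simp add: Mr)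
  qed
qed

lemma greedy_coins_add_large:
  assumes "0 < K"
  shows "greedy_coins k K (r + K) = greedy_coins k K r + 1"
  using assms by (simp add: greedy_coins_def)

section \<open>Semigroup elements in terms of coin counts\<close>

locale coin_sequence =
  fixes a h d k K :: int
  assumes a: "0 < a" and h: "0 < h" and d: "0 < d" and k: "0 < k" and kK: "k < K"
begin

abbreviation "M \<equiv> greedy_coins k K"

text \<open>Minimality of the greedy count: \<open>n\<close> counts the generators other than
  \<open>a\<close>, and each of them raises \<open>M R\<close> by at most one.\<close>

lemma representable_imp_coins:
  assumes "representable (seqA a h d k K) m"
  shows "\<exists>x n R. 0 \<le> x \<and> 0 \<le> R \<and> M R \<le> n \<and> m = x * a + n * (h * a) + R * d"
  using assms
proof (induction rule: representable_induct)
  case zero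
  have "M 0 = 0" using k by (simp add: greedy_coins_def)
  then show ?case by (intro exI[of _ 0]) simp
next
  case (add y g)
  then obtain x n R where y: "0 \<le> x" "0 \<le> R" "M R \<le> n" "y = x * a + n * (h * a) + R * d"
    by blast
  consider "g = a" | i where "1 \<le> i" "i \<le> k" "g = h * a + i * d" | "g = h * a + K * d"
    using add.hyps by (auto simp: set_seqA)
  then show ?case
  proof cases
    case 1
    then show ?thesis
      using y by (intro exI[of _ "x + 1"] exI[of _ n] exI[of _ R]) (auto simp: algebra_simps)
  next
    case 2
    moreover have "M (R + i) \<le> n + 1"
      using greedy_coins_add_small[of k K i R] k kK 2 y by simp
    ultimately show ?thesis
      using y by (intro exI[of _ x] exI[of _ "n + 1"] exI[of _ "R + i"])
        (auto simp: algebra_simps)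
  next
    case 3
    moreover have "M (R + K) \<le> n + 1"
      using greedy_coins_add_large[of K k R] k kK y by simp
    ultimately show ?thesis
      using y k kK by (intro exI[of _ x] exI[of _ "n + 1"] exI[of _ "R + K"])
        (auto simp: algebra_simps)
  qed
qed

text \<open>The greedy count is attained: \<open>q\<close> coins \<open>K\<close>, then for a
  nonzero remainder \<open>u\<close> another \<open>c - 1\<close> coins \<open>k\<close> and one
  coin for what is left.\<close>

lemma representable_coins:
  assumes "0 \<le> x" "0 \<le> R"
  shows "representable (seqA a h d k K) (x * a + M R * (h * a) + R * d)"
proof -
  let ?rep = "representable (seqA a h d k K)"
  define q u c where quc: "q = R div K" "u = R mod K" "c = (u + k - 1) div k"
  have K: "0 < K" using k kK by simp
  have R: "R = q * K + u" and u: "0 \<le> u" and q: "0 \<le> q"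
    using K assms by (auto simp: quc pos_imp_zdiv_nonneg_iff)
  have MR: "M R = q + c"
    by (simp add: greedy_coins_def quc)
  have c: "0 \<le> c" "u \<le> c * k" "\<not> u \<le> (c - 1) * k"
    using u k ceil_div_le_iff[OF k, of u c] ceil_div_le_iff[OF k, of u "c - 1"]
    by (auto simp: quc(3) pos_imp_zdiv_nonneg_iff)
  have "?rep a" "?rep (h * a + K * d)"
    by (auto intro!: representable_member simp: set_seqA)
  then have 1: "?rep (x * a)" "?rep (q * (h * a + K * d))"
    using assms q by (auto intro: representable_mult)
  have 2: "?rep (c * (h * a) + u * d)"
  proof (cases "c = 0")
    case True
    then show ?thesis using c u by (simp add: representable_0)
  next
    case False
    \<comment> \<open>The last coin is legal because \<open>c\<close> is the least number with u
      \<le> c * k.\<close>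
    have i: "u - (c - 1) * k \<in> {1..k}"
      using c by (auto simp: algebra_simps)
    have "?rep (h * a + k * d)" "?rep (h * a + (u - (c - 1) * k) * d)"
      using k i by (auto intro!: representable_member simp only: set_seqA) auto
    then have "?rep ((c - 1) * (h * a + k * d) + (h * a + (u - (c - 1) * k) * d))"
      using False c by (intro representable_add[OF representable_mult[of _ "h * a + k * d"]]) auto
    then show ?thesis by (simp add: algebra_simps)
  qed
  have "x * a + M R * (h * a) + R * d = x * a + q * (h * a + K * d) + (c * (h * a) + u * d)"
    unfolding MR by (subst R) (simp add: algebra_simps)
  then show ?thesis
    using representable_add[OF representable_add[OF 1] 2] by (simp only:)
qed

end

section \<open>Reduction of the Frobenius number to a maximum over residues\<close>

text \<open>\<open>K_lower\<close> and \<open>K_upper\<close> together encode ceil((K - 1) / k) = S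
  + 1 without division.\<close>

locale long_coin_sequence = coin_sequence +
  fixes S :: int
  assumes S: "1 \<le> S" and K_lower: "S * k + 2 \<le> K" and K_upper: "K \<le> (S + 1) * k + 1"
    and aS: "S * K \<le> a" and dS: "d \<le> h * S" and coprime: "gcd a d = 1"
begin

lemma K: "0 < K"
  using k kK by simp

lemma coins_le: "M r \<le> r div K + S + 1"
proof -
  have "r mod K \<le> (S + 1) * k"
    using K K_upper pos_mod_bound[OF K, of r] by linarith
  then show ?thesis
    using ceil_div_le_iff[OF k, of "r mod K" "S + 1"] by (simp add: greedy_coins_def)
qed

text \<open>\<open>M\<close> is not monotone: \<open>M (K - 1)\<close> is \<open>S + 1\<close> but
  \<open>M K\<close> is 1. A shift by \<open>S\<close> blocks repairs this. If the quotient grows by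
  exactly \<open>S\<close>, the remainder cannot drop; if it grows by more, the extra
  \<open>S + 1\<close> already covers the largest possible ceiling.\<close>

lemma coins_mono_shift:
  assumes "r + S * K \<le> R"
  shows "M r \<le> M R"
proof -
  have "(r + S * K) div K \<le> R div K"
    using assms K by (rule zdiv_mono1)
  then have le: "r div K + S \<le> R div K"
    using K by simp
  have nonneg: "0 \<le> (R mod K + k - 1) div k"
    using k pos_mod_sign[OF K, of R] by (subst pos_imp_zdiv_nonneg_iff) auto
  show ?thesis
  proof (cases "r div K + S = R div K")
    case True
    have "r = r div K * K + r mod K" by simp
    moreover have "R = (r div K + S) * K + R mod K" unfolding True by simp
    ultimately have "r mod K \<le> R mod K"
      using assms unfolding distrib_right by linarith
    then have "(r mod K + k - 1) div k \<le> (R mod K + k - 1) div k"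
      using k by (intro zdiv_mono1) auto
    then show ?thesis using True S by (simp add: greedy_coins_def)
  next
    case False
    then show ?thesis
      using le nonneg coins_le[of r] by (simp add: greedy_coins_def)
  qed
qed

text \<open>The Brauer-Shockley formula: the Frobenius number is the largest of the least elements
  of the residue classes modulo \<open>a\<close>, minus \<open>a\<close>.\<close>

lemma frobenius_eqI:
  assumes r0: "0 \<le> r0" "r0 < a"
    and max: "\<And>r. 0 \<le> r \<Longrightarrow> r < a \<Longrightarrow> M r * (h * a) + r * d \<le> M r0 * (h * a) + r0 * d"
  shows "frobenius (seqA a h d k K) = M r0 * (h * a) + r0 * d - a"
  unfolding frobenius_def
proof (rule Greatest_equality)
  let ?F = "M r0 * (h * a) + r0 * d - a"
  show "\<not> representable (seqA a h d k K) ?F"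
  proof
    assume "representable (seqA a h d k K) ?F"
    then obtain x n R where R: "0 \<le> x" "0 \<le> R" "M R \<le> n"
      and eq: "?F = x * a + n * (h * a) + R * d"
      using representable_imp_coins by blast
    have "(r0 - R) * d = a * (x + n * h - M r0 * h + 1)"
      using eq by (simp add: algebra_simps)
    then have "a dvd (r0 - R) * d" by simp
    then have "a dvd r0 - R"
      using coprime by (simp add: coprime_dvd_mult_left_iff coprime_iff_gcd_eq_1)
    \<comment> \<open>Since 0 \<le> R and r0 < a, either \<open>R = r0\<close> or \<open>R\<close>
      lies at least a \<ge> S * K above \<open>r0\<close>; in both cases it needs no fewer
      coins.\<close>
    then obtain l where l: "r0 - R = a * l" by blast
    have "a * l < a * 1" using l r0 R by linarith
    then have "l < 1" using a mult_less_cancel_left_pos by blast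
    then have "l \<le> 0" by simp
    have "r0 \<le> R \<and> M r0 \<le> M R"
    proof (cases "l = 0")
      case True
      then show ?thesis using l by simp
    next
      case False
      then have "a * l \<le> a * - 1"
        using \<open>l \<le> 0\<close> a by (intro mult_left_mono) auto
      then have "r0 + a \<le> R" using l by simp
      then show ?thesis using a aS by (auto intro: coins_mono_shift)
    qed
    then have "M r0 * (h * a) \<le> n * (h * a)" "r0 * d \<le> R * d"
      using R a h d by (auto intro!: mult_right_mono)
    moreover have "0 \<le> x * a" using R a by simp
    ultimately show False using eq a by linarith
  qed
  show "m \<le> ?F" if m: "\<not> representable (seqA a h d k K) m" for m
  proof (rule ccontr)
    assume "\<not> m \<le> ?F"
    \<comment> \<open>Bezout supplies the \<open>r\<close> in the range 0 \<le> r < a with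
      \<open>r * d\<close> congruent to \<open>m\<close> modulo \<open>a\<close>.\<close>
    obtain v w where vw: "v * a + w * d = 1"
      using bezout_int[of a d] coprime by auto
    define r where "r = (m * w) mod a"
    have r: "0 \<le> r" "r < a" using a by (auto simp: r_def)
    have mw: "m * w = (m * w) div a * a + r" by (simp add: r_def)
    have "m = m * (v * a + w * d)" by (simp add: vw)
    also have "\<dots> = (m * v) * a + (m * w) * d" by (simp add: algebra_simps)
    also have "\<dots> = (m * v + (m * w) div a * d) * a + r * d"
      by (subst mw) (simp add: algebra_simps)
    finally obtain y where y: "m = y * a + r * d" by blast
    have "M r * (h * a) + r * d - a < m"
      using max[OF r] \<open>\<not> m \<le> ?F\<close> by linarith
    \<comment> \<open>\<open>m\<close> and the least element of its class differ by a multiple of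
      \<open>a\<close>, so exceeding that element minus \<open>a\<close> means reaching it.\<close>
    then have "(M r * h) * a < (y + 1) * a"
      using y by (simp add: algebra_simps)
    then have "0 \<le> y - M r * h"
      using a by (simp add: mult_less_cancel_right_pos)
    from representable_coins[OF this r(1)] show False
      using m y by (simp add: algebra_simps)
  qed
qed

section \<open>Locating the maximum below \<open>a\<close>\<close>

text \<open>The largest remainder in the incomplete last block is \<open>a mod K - 1\<close>, which
  accounts for the \<open>+ 1\<close> in the bound on \<open>a mod K\<close>.\<close>

lemma coins_last_block:
  assumes "a div K * K \<le> r" "r < a" "a mod K \<le> c * k + 1"
  shows "M r \<le> a div K + c"
proof -
  have a_eq: "a = a div K * K + a mod K" by simp
  have "M (a div K * K + (r - a div K * K)) = a div K + (r - a div K * K + k - 1) div k"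
    using assms a_eq pos_mod_bound[OF K, of a] by (intro greedy_coins_block) linarith+
  moreover have "(r - a div K * K + k - 1) div k \<le> c"
    using assms a_eq by (subst ceil_div_le_iff[OF k]) linarith
  ultimately show ?thesis by simp
qed

lemma coins_earlier_block:
  assumes "r < a div K * K"
  shows "M r \<le> a div K + S"
proof -
  have "r div K < a div K"
    using assms zdiv_less_iff[OF K] by blast
  then show ?thesis using coins_le[of r] by simp
qed

lemma quotient_pos: "1 \<le> a div K"
proof -
  have "1 * K \<le> S * K" using S K by (intro mult_right_mono) auto
  then have "1 * K \<le> a" using aS by linarith
  then show ?thesis using zdiv_less_iff[OF K, of a 1] by linarith
qed

lemma Kd_le: "K * d \<le> h * a"
proof -
  have "K * d \<le> K * (h * S)" using dS K by (intro mult_left_mono) auto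
  also have "\<dots> = h * (S * K)" by (simp add: algebra_simps)
  also have "\<dots> \<le> h * a" using aS h by (intro mult_left_mono) auto
  finally show ?thesis .
qed

lemma value_mono:
  assumes "m \<le> m'" "r \<le> r'"
  shows "m * (h * a) + r * d \<le> m' * (h * a) + r' * d"
  using assms a h d by (intro add_mono mult_right_mono) auto

text \<open>One coin weighs \<open>h * a\<close>, at least as much as \<open>K * d\<close>, so a
  saved coin pays for an increase of \<open>r\<close> by up to \<open>K\<close>.\<close>

lemma value_mono_strict:
  assumes "m + 1 \<le> m'" "r \<le> r' + K"
  shows "m * (h * a) + r * d \<le> m' * (h * a) + r' * d"
proof -
  have "(m + 1) * (h * a) \<le> m' * (h * a)" "r * d \<le> (r' + K) * d"
    using assms a h d by (auto intro!: mult_right_mono)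
  then show ?thesis using Kd_le by (simp add: algebra_simps)
qed

text \<open>The last block needs at most \<open>a div K + S - 1\<close> coins, one fewer than the
  end of the last complete block, so the maximum sits at that end.\<close>

lemma frobenius_small_residue:
  assumes "a mod K \<le> (S - 1) * k + 1"
  shows "frobenius (seqA a h d k K) = (a div K + S) * h * a + K * d * (a div K) - a - d"
proof -
  let ?Q = "a div K"
  have a_eq: "a = ?Q * K + a mod K" by simp
  have j: "0 \<le> a mod K" "a mod K < K" using K by simp_all
  have QK: "1 * K \<le> ?Q * K" using quotient_pos K by (intro mult_right_mono) auto
  \<comment> \<open>\<open>?Q * K - 1\<close> is written as the last position of block
    \<open>?Q - 1\<close>, where the remainder \<open>K - 1\<close> needs the full
    \<open>S + 1\<close> coins.\<close>
  have "M ((?Q - 1) * K + (K - 1)) = ?Q - 1 + (K - 1 + k - 1) div k"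
    using K by (intro greedy_coins_block) auto
  moreover have "(K - 1 + k - 1) div k = S + 1"
    using ceil_div_le_iff[OF k, of "K - 1" "S + 1"] ceil_div_le_iff[OF k, of "K - 1" S]
      K_lower K_upper by linarith
  moreover have "(?Q - 1) * K + (K - 1) = ?Q * K - 1" by (simp add: algebra_simps)
  ultimately have M0: "M (?Q * K - 1) = ?Q + S" by simp
  have "frobenius (seqA a h d k K) = M (?Q * K - 1) * (h * a) + (?Q * K - 1) * d - a"
  proof (rule frobenius_eqI)
    show "0 \<le> ?Q * K - 1" "?Q * K - 1 < a" using QK K a_eq j by linarith+
    fix r assume r: "0 \<le> r" "r < a"
    show "M r * (h * a) + r * d \<le> M (?Q * K - 1) * (h * a) + (?Q * K - 1) * d"
    proof (cases "r < ?Q * K")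
      case True
      then show ?thesis using coins_earlier_block[of r] by (intro value_mono) (auto simp: M0)
    next
      case False
      then have "M r \<le> ?Q + (S - 1)"
        using r assms by (intro coins_last_block) auto
      then show ?thesis
        using r a_eq j by (intro value_mono_strict) (simp add: M0, linarith)
    qed
  qed
  then show ?thesis unfolding M0 by (simp add: algebra_simps)
qed

text \<open>Here c = ceil((a mod K - 1) / k) is the cost of the remainder of \<open>a - 1\<close>.
  As c \<ge> S, no earlier block needs more coins, and \<open>a - 1\<close> is also the largest
  \<open>r\<close>. Taking \<open>c\<close> as \<open>S\<close> or \<open>S + 1\<close> yields the
  last two formulas.\<close>

lemma frobenius_large_residue:
  assumes c: "S \<le> c" and j: "(c - 1) * k + 2 \<le> a mod K" "a mod K \<le> c * k + 1"
  shows "frobenius (seqA a h d k K)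
    = (a div K + c) * h * a + K * d * (a div K) - a + (a mod K - 1) * d"
proof -
  let ?Q = "a div K"
  have a_eq: "a = ?Q * K + a mod K" by simp
  have jK: "a mod K < K" using K by simp
  have "0 \<le> (c - 1) * k" using c S k by simp
  then have j2: "2 \<le> a mod K" using j by linarith
  have "M (?Q * K + (a mod K - 1)) = ?Q + (a mod K - 1 + k - 1) div k"
    using j2 jK by (intro greedy_coins_block) auto
  moreover have "(a mod K - 1 + k - 1) div k = c"
    using ceil_div_le_iff[OF k, of "a mod K - 1" c]
      ceil_div_le_iff[OF k, of "a mod K - 1" "c - 1"] j by linarith
  moreover have "?Q * K + (a mod K - 1) = a - 1" using a_eq by linarith
  ultimately have M0: "M (a - 1) = ?Q + c" by simp
  have "frobenius (seqA a h d k K) = M (a - 1) * (h * a) + (a - 1) * d - a"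
  proof (rule frobenius_eqI)
    show "0 \<le> a - 1" "a - 1 < a" using a by simp_all
    fix r assume r: "0 \<le> r" "r < a"
    have "M r \<le> ?Q + c"
    proof (cases "r < ?Q * K")
      case True
      then show ?thesis using coins_earlier_block[of r] c by simp
    next
      case False
      then show ?thesis using r j by (intro coins_last_block) auto
    qed
    then show "M r * (h * a) + r * d \<le> M (a - 1) * (h * a) + (a - 1) * d"
      using r by (intro value_mono) (auto simp: M0)
  qed
  moreover have "(a - 1) * d = K * d * ?Q + (a mod K - 1) * d"
    using arg_cong[OF a_eq, of "\<lambda>x. (x - 1) * d"] by (simp only: algebra_simps)
  ultimately show ?thesis unfolding M0 by (simp add: algebra_simps)
qed

lemma frobenius_cases:
  "(a mod K \<in> {0..(S - 1) * k + 1} \<longrightarrow>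
      frobenius (seqA a h d k K) = (a div K + S) * h * a + K * d * (a div K) - a - d) \<and>
   (a mod K \<in> {(S - 1) * k + 2..S * k + 1} \<longrightarrow>
      frobenius (seqA a h d k K)
        = (a div K + S) * h * a + K * d * (a div K) - a + (a mod K - 1) * d) \<and>
   (a mod K \<in> {S * k + 2..K - 1} \<longrightarrow>
      frobenius (seqA a h d k K)
        = (a div K + S + 1) * h * a + K * d * (a div K) - a + (a mod K - 1) * d)"
  using frobenius_small_residue frobenius_large_residue[of S] frobenius_large_residue[of "S + 1"]
    K_upper by (auto simp: add.assoc)

end

section \<open>Specialization to the two ranges of \<open>t\<close>\<close>

lemma ceiling_divide_le_imp:
  fixes d h S :: int
  assumes "1 \<le> S" "\<lceil>real_of_int d / real_of_int S\<rceil> \<le> h"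
  shows "d \<le> h * S"
proof -
  have "real_of_int d / real_of_int S \<le> real_of_int h"
    using assms(2) by (simp add: ceiling_le_iff)
  then have "real_of_int d \<le> real_of_int (h * S)"
    using assms(1) by (simp add: divide_le_eq)
  then show ?thesis by (simp only: of_int_le_iff)
qed

theorem theorem4p8:
  fixes a h d k K s t Q j :: int
  assumes "a > 0" "h > 0" "d > 0" "k > 0" "K > 0"
    and "gcd a d = 1"
    and "K - 1 > k" "k \<ge> 2"
    and "K = s * k + t" "0 \<le> t" "t \<le> k - 1" "s \<ge> 1"
    and "Q = \<lfloor>real_of_int a / real_of_int K\<rfloor>"
    and "j = a mod K"
  shows
    "(2 \<le> t \<and> t \<le> k - 1 \<and> h \<ge> \<lceil>real_of_int d / real_of_int s\<rceil> \<and> a \<ge> s * K \<longrightarrow>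
        (j \<in> {0..(s - 1) * k + 1} \<longrightarrow>
           frobenius (seqA a h d k K) = (Q + s) * h * a + K * d * Q - a - d) \<and>
        (j \<in> {(s - 1) * k + 2..s * k + 1} \<longrightarrow>
           frobenius (seqA a h d k K) = (Q + s) * h * a + K * d * Q - a + (j - 1) * d) \<and>
        (j \<in> {s * k + 2..K - 1} \<longrightarrow>
           frobenius (seqA a h d k K) = (Q + s + 1) * h * a + K * d * Q - a + (j - 1) * d))
     \<and>
     (t \<in> {0, 1} \<and> h \<ge> \<lceil>real_of_int d / real_of_int (s - 1)\<rceil> \<and> a \<ge> (s - 1) * K \<longrightarrow>
        (j \<in> {0..(s - 2) * k + 1} \<longrightarrow>
           frobenius (seqA a h d k K) = (Q + s - 1) * h * a + K * d * Q - a - d) \<and>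
        (j \<in> {(s - 2) * k + 2..(s - 1) * k + 1} \<longrightarrow>
           frobenius (seqA a h d k K) = (Q + s - 1) * h * a + K * d * Q - a + (j - 1) * d) \<and>
        (j \<in> {(s - 1) * k + 2..K - 1} \<longrightarrow>
           frobenius (seqA a h d k K) = (Q + s) * h * a + K * d * Q - a + (j - 1) * d))"
proof -
  have Q: "Q = a div K"
    unfolding assms by (rule floor_divide_of_int_eq)
  have j: "j = a mod K" by fact
  have inst: "long_coin_sequence a h d k K S"
    if "1 \<le> S" "S * k + 2 \<le> K" "K \<le> (S + 1) * k + 1" "S * K \<le> a"
      "\<lceil>real_of_int d / real_of_int S\<rceil> \<le> h" for S
    using assms that ceiling_divide_le_imp[of S d h] by unfold_locales auto
  show ?thesis
  proof (intro conjI[of "_ \<longrightarrow> _" "_ \<longrightarrow> _"] impI, goal_cases)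
    case 1
    \<comment> \<open>2 \<le> t gives the lower bound on \<open>K\<close>, and t \<le> k - 1 the
      upper one.\<close>
    then have "long_coin_sequence a h d k K s"
      using assms by (intro inst) (auto simp: algebra_simps)
    from long_coin_sequence.frobenius_cases[OF this] show ?case
      unfolding Q j .
  next
    case 2
    \<comment> \<open>With t \<le> 1, the value s = 1 would force K - 1 \<le> k. Hence
      \<open>s - 1\<close> is positive and can serve as \<open>S\<close>; the lower bound on
      \<open>K\<close> then comes from 2 \<le> k.\<close>
    have "s \<noteq> 1" using 2 assms by auto
    then have "long_coin_sequence a h d k K (s - 1)"
      using assms 2 by (intro inst) (auto simp: algebra_simps)
    from long_coin_sequence.frobenius_cases[OF this] show ?case
      unfolding Q j by (simp add: algebra_simps)
  qed
qed

end
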